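(* Let $\eta=(\eta_1,\dots,\eta_p)$ be a composition of $n$ with positive parts and let $\gamma\in\mathbb{Z}^n$ with $\gamma_1+\cdots+\gamma_n=0$. Then $K_{\Phi(\eta)}(\gamma\mid q)\neq0$ if and only if $\gamma\in Y_\eta$. Moreover, in that case $$\deg_q K_{\Phi(\eta)}(\gamma\mid q)=\sum_{k=1}^{p-1}(p-k)\sum_{j=r_{k-1}+1}^{r_k}\gamma_j .$$
   Context: $r_k=\eta_1+\cdots+\eta_k$ for $k\ge1$, $r_0=0$. $\Phi(\eta)=\{(i,j)\in\mathbb{Z}^2:1\le i\le r_k<j\le n\text{ for some }1\le k\le p\}$. $K_{\Phi(\eta)}(\gamma\mid q)$ is the coefficient of $x^\gamma$ in $\prod_{(i,j)\in\Phi(\eta)}(1-qx_i/x_j)^{-1}=\prod\sum_{m\ge0}q^m(x_i/x_j)^m$. $Y_\eta$ is the set of $\gamma\in\mathbb{Z}^n$ with $\sum_i\gamma_i=0$ such that for each $k$ with $0\le k\le p-1$ and every subset $\Omega_k\subseteq\{r_k+1,\dots,r_{k+1}\}$ one has $\sum_{j=1}^{r_k}\gamma_j+\sum_{a\in\Omega_k}\gamma_a\ge0$. *)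

theory Defs
  imports Complex_Main "HOL-Library.FuncSet" "HOL-Computational_Algebra.Polynomial"
begin

text \<open>
  Vectors in \<open>\<int>\<^sup>n\<close> are functions \<open>nat \<Rightarrow> int\<close> vanishing outside \<open>{1..n}\<close>, with
  coordinates numbered from 1. A composition is the list of its parts.
\<close>

definition int_vecs :: "nat \<Rightarrow> (nat \<Rightarrow> int) set" where
  "int_vecs n = {\<gamma>. \<forall>i. i \<notin> {1..n} \<longrightarrow> \<gamma> i = 0}"

definition is_composition :: "nat \<Rightarrow> nat list \<Rightarrow> bool" where
  "is_composition n \<eta> \<longleftrightarrow> (\<forall>a \<in> set \<eta>. 0 < a) \<and> sum_list \<eta> = n"

definition psum :: "nat list \<Rightarrow> nat \<Rightarrow> nat" where
  "psum \<eta> k = sum_list (take k \<eta>)"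

definition roots :: "nat list \<Rightarrow> (nat \<times> nat) set" where
  "roots \<eta> = {(i, j). \<exists>k \<in> {1..length \<eta>}.
      1 \<le> i \<and> i \<le> psum \<eta> k \<and> psum \<eta> k < j \<and> j \<le> sum_list \<eta>}"

text \<open>
  A formal series in the Laurent monomials \<open>x\<^sup>\<alpha>\<close> with coefficients in \<open>\<int>[q]\<close>
  is the function sending the exponent vector \<open>\<alpha>\<close> to its coefficient.
\<close>

type_synonym series = "(nat \<Rightarrow> int) \<Rightarrow> int poly"

text \<open>The exponent vector of \<open>x\<^sub>i / x\<^sub>j\<close>.\<close>

definition root_vec :: "nat \<Rightarrow> nat \<Rightarrow> nat \<Rightarrow> int" where
  "root_vec i j = (\<lambda>l. of_bool (l = i) - of_bool (l = j))"

text \<open>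
  The series \<open>\<Sum>m\<ge>0. q\<^sup>m (x\<^sub>i / x\<^sub>j)\<^sup>m\<close>, that is, the expansion of
  \<open>1 / (1 - q x\<^sub>i / x\<^sub>j)\<close>. For \<open>i \<noteq> j\<close> at most one \<open>m\<close> contributes to a given
  exponent; the polynomial variable is \<open>q\<close>, so \<open>monom 1 m\<close> is \<open>q\<^sup>m\<close>.
\<close>

definition geom_series :: "nat \<Rightarrow> nat \<Rightarrow> series" where
  "geom_series i j \<alpha> = (\<Sum>m | \<alpha> = (\<lambda>l. int m * root_vec i j l). monom 1 m)"

text \<open>
  The product of a finite family of series: the coefficient of \<open>x\<^sup>\<gamma>\<close> is the sum, over
  all ways of picking one term from each factor with exponents adding up to \<open>\<gamma>\<close>, of the
  products of the coefficients. This is meaningful only when finitely many choices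
  contribute, which \<open>finite_decomps_roots\<close> below shows for the family at hand.
\<close>

definition decomps :: "'r set \<Rightarrow> ('r \<Rightarrow> series) \<Rightarrow> (nat \<Rightarrow> int) \<Rightarrow> ('r \<Rightarrow> nat \<Rightarrow> int) set" where
  "decomps R F \<gamma> = {\<alpha> \<in> (\<Pi>\<^sub>E r\<in>R. {a. F r a \<noteq> 0}). (\<lambda>l. \<Sum>r\<in>R. \<alpha> r l) = \<gamma>}"

definition series_prod :: "'r set \<Rightarrow> ('r \<Rightarrow> series) \<Rightarrow> series" where
  "series_prod R F \<gamma> = (\<Sum>\<alpha>\<in>decomps R F \<gamma>. \<Prod>r\<in>R. F r (\<alpha> r))"

definition K_poly :: "(nat \<times> nat) set \<Rightarrow> (nat \<Rightarrow> int) \<Rightarrow> int poly" where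
  "K_poly \<Phi> \<gamma> = series_prod \<Phi> (\<lambda>(i, j). geom_series i j) \<gamma>"

definition Y_set :: "nat list \<Rightarrow> (nat \<Rightarrow> int) set" where
  "Y_set \<eta> = {\<gamma> \<in> int_vecs (sum_list \<eta>).
      (\<Sum>i = 1..sum_list \<eta>. \<gamma> i) = 0 \<and>
      (\<forall>k < length \<eta>. \<forall>\<Omega> \<subseteq> {psum \<eta> k + 1..psum \<eta> (k + 1)}.
        (\<Sum>j = 1..psum \<eta> k. \<gamma> j) + (\<Sum>a\<in>\<Omega>. \<gamma> a) \<ge> 0)}"

lemma geom_series_nonzeroE:
  assumes "geom_series i j a \<noteq> 0"
  obtains m where "a = (\<lambda>l. int m * root_vec i j l)"
proof -
  have "{m. a = (\<lambda>l. int m * root_vec i j l)} \<noteq> {}"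
    using assms unfolding geom_series_def by (metis sum.empty)
  then show thesis using that by blast
qed

lemma geom_series_multiple:
  assumes "i \<noteq> j"
  shows "geom_series i j (\<lambda>l. int m * root_vec i j l) = monom 1 m"
proof -
  have "{m'. (\<lambda>l. int m * root_vec i j l) = (\<lambda>l. int m' * root_vec i j l)} = {m}"
    using assms by (auto simp: root_vec_def fun_eq_iff)
  then show ?thesis by (simp add: geom_series_def)
qed

lemma roots_subset: "roots \<eta> \<subseteq> {(i, j). 1 \<le> i \<and> i < j \<and> j \<le> sum_list \<eta>}"
  unfolding roots_def by auto

lemma finite_roots: "finite (roots \<eta>)"
  by (rule finite_subset[of _ "{..sum_list \<eta>} \<times> {..sum_list \<eta>}"]) (auto simp: roots_def)

lemma finite_decomps_roots:
  "finite (decomps (roots \<eta>) (\<lambda>(i, j). geom_series i j) \<gamma>)"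
proof -
  let ?R = "roots \<eta>" and ?n = "sum_list \<eta>"
  define H where "H = (\<lambda>v :: nat \<Rightarrow> int. \<Sum>l\<in>{1..?n}. - int l * v l)"
  have H_root: "H (\<lambda>l. int m * root_vec i j l) = int m * (int j - int i)"
    if "(i, j) \<in> ?R" for i j m
  proof -
    have ij: "i \<in> {1..?n}" "j \<in> {1..?n}" using that roots_subset[of \<eta>] by auto
    have "H (\<lambda>l. int m * root_vec i j l)
        = (\<Sum>l\<in>{1..?n}. if l = j then int m * int l else 0)
          - (\<Sum>l\<in>{1..?n}. if l = i then int m * int l else 0)"
      unfolding H_def sum_subtractf[symmetric]
      by (rule sum.cong) (auto simp: root_vec_def)
    also have "\<dots> = int m * int j - int m * int i"
      using ij by simp
    finally show ?thesis by (simp add: right_diff_distrib)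
  qed
  let ?B = "\<lambda>(i, j). (\<lambda>m l. int m * root_vec i j l) ` {..nat (H \<gamma>)}"
  have "decomps ?R (\<lambda>(i, j). geom_series i j) \<gamma> \<subseteq> (\<Pi>\<^sub>E r\<in>?R. ?B r)"
  proof
    fix \<alpha> assume \<alpha>: "\<alpha> \<in> decomps ?R (\<lambda>(i, j). geom_series i j) \<gamma>"
    have ext: "\<alpha> \<in> extensional ?R" and sum: "(\<lambda>l. \<Sum>r\<in>?R. \<alpha> r l) = \<gamma>"
      using \<alpha> by (auto simp: decomps_def PiE_def)
    have mult: "\<exists>m. \<alpha> (i, j) = (\<lambda>l. int m * root_vec i j l)" if "(i, j) \<in> ?R" for i j
    proof -
      have "geom_series i j (\<alpha> (i, j)) \<noteq> 0"
        using \<alpha> that by (fastforce simp: decomps_def PiE_def Pi_def)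
      then show ?thesis by (rule geom_series_nonzeroE) blast
    qed
    have nonneg: "H (\<alpha> r) \<ge> 0" if rR: "r \<in> ?R" for r
    proof -
      obtain i j where r: "r = (i, j)" by (cases r)
      obtain m where "\<alpha> r = (\<lambda>l. int m * root_vec i j l)" using mult rR r by blast
      then show ?thesis using H_root rR r roots_subset[of \<eta>] by auto
    qed
    have "H \<gamma> = (\<Sum>r\<in>?R. H (\<alpha> r))"
      unfolding H_def sum[symmetric] sum_distrib_left by (rule sum.swap)
    then have le: "H (\<alpha> r) \<le> H \<gamma>" if "r \<in> ?R" for r
      using member_le_sum[of r ?R "\<lambda>r. H (\<alpha> r)"] that nonneg finite_roots by simp
    have "\<alpha> (i, j) \<in> ?B (i, j)" if r: "(i, j) \<in> ?R" for i j
    proof -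
      obtain m where m: "\<alpha> (i, j) = (\<lambda>l. int m * root_vec i j l)" using mult r by blast
      have "i < j" using r roots_subset[of \<eta>] by auto
      then have "int m * 1 \<le> int m * (int j - int i)" by (intro mult_left_mono) auto
      then have "int m \<le> H \<gamma>" using le[OF r] H_root[OF r] m by simp
      then have "m \<in> {..nat (H \<gamma>)}" by simp
      then show ?thesis using m by blast
    qed
    then show "\<alpha> \<in> (\<Pi>\<^sub>E r\<in>?R. ?B r)" using ext by (auto simp: PiE_def)
  qed
  moreover have "finite (\<Pi>\<^sub>E r\<in>?R. ?B r)"
    by (rule finite_PiE) (auto simp: finite_roots)
  ultimately show ?thesis by (rule finite_subset)
qed

end

theory Submission imports Defs begin

text \<open>
  The coefficient of \<open>x\<^sup>\<gamma>\<close> counts the ways of writing \<open>\<gamma>\<close> as a sum of roots, graded by the number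
  of roots used. No root leads from outside a set \<open>{1..r\<^sub>k} \<union> \<Omega>\<^sub>k\<close> into it, so the sum of \<open>\<gamma>\<close>
  over such a set is nonnegative as soon as one such way exists. The sum of the \<open>\<gamma>\<^sub>1 + \<dots> + \<gamma>\<^bsub>r\<^sub>k\<^esub>\<close> for
  \<open>1 \<le> k < p\<close> is linear in \<open>\<gamma>\<close>, and on a root it is the number of blocks crossed; hence it
  bounds the degree, with equality when only roots between adjacent blocks occur. Conversely,
  every nonzero \<open>\<gamma> \<in> Y\<^sub>\<eta>\<close> admits such a root whose subtraction stays in \<open>Y\<^sub>\<eta>\<close>: it leads from a
  positive entry of the first nonzero block to an entry of the next block that is negative, if
  possible.
\<close>

section \<open>Coefficients as generating functions of root decompositions\<close>

definition root_decomps :: "(nat \<times> nat) set \<Rightarrow> (nat \<Rightarrow> int) \<Rightarrow> (nat \<times> nat \<Rightarrow> nat) set" where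
  "root_decomps R \<gamma> = {m \<in> R \<rightarrow>\<^sub>E UNIV.
     (\<lambda>l. \<Sum>r\<in>R. int (m r) * root_vec (fst r) (snd r) l) = \<gamma>}"

text \<open>Written as a sum over initial segments, so that each summand is the sum of
  \<open>\<gamma>\<close> over one set and \<open>sum_root_decomp\<close> applies to it.\<close>

definition block_height :: "nat list \<Rightarrow> (nat \<Rightarrow> int) \<Rightarrow> int" where
  "block_height \<eta> \<gamma> = (\<Sum>k = 1..length \<eta> - 1. \<Sum>j = 1..psum \<eta> k. \<gamma> j)"

lemma sum_root_vec:
  assumes "finite S"
  shows "(\<Sum>l\<in>S. root_vec i j l) = of_bool (i \<in> S) - of_bool (j \<in> S)"
  using assms by (simp add: root_vec_def sum_subtractf of_bool_def)

text \<open>A nonzero term of \<open>geom_series i j\<close> sits at a natural multiple of the root,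
  and since \<open>i \<noteq> j\<close> the multiplicity can be read off at coordinate
  \<open>i\<close>.\<close>

lemma bij_betw_root_decomps:
  assumes irrefl: "\<And>i j. (i, j) \<in> R \<Longrightarrow> i \<noteq> j"
  shows "bij_betw (\<lambda>m. \<lambda>r\<in>R. \<lambda>l. int (m r) * root_vec (fst r) (snd r) l)
    (root_decomps R \<gamma>) (decomps R (\<lambda>(i, j). geom_series i j) \<gamma>)"
    (is "bij_betw ?f _ ?D")
proof (rule bij_betw_imageI)
  show "inj_on ?f (root_decomps R \<gamma>)"
  proof (rule inj_onI)
    fix m m' assume m: "m \<in> root_decomps R \<gamma>" "m' \<in> root_decomps R \<gamma>" and eq: "?f m = ?f m'"
    have "m r = m' r" if "r \<in> R" for r
    proof -
      have "fst r \<noteq> snd r" using irrefl[of "fst r" "snd r"] that by simp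
      moreover have "int (m r) * root_vec (fst r) (snd r) (fst r)
          = int (m' r) * root_vec (fst r) (snd r) (fst r)"
        using fun_cong[OF eq, of r] that by (auto dest: fun_cong)
      ultimately show ?thesis by (simp add: root_vec_def)
    qed
    \<comment> \<open>Agreement on \<open>R\<close> suffices because members of
      \<open>root_decomps\<close> are extensional.\<close>
    then show "m = m'" using m by (auto simp: root_decomps_def intro: PiE_ext)
  qed
  show "?f ` root_decomps R \<gamma> = ?D"
  proof (intro equalityI subsetI)
    fix \<alpha> assume "\<alpha> \<in> ?f ` root_decomps R \<gamma>"
    then obtain m where m: "m \<in> root_decomps R \<gamma>" and \<alpha>: "\<alpha> = ?f m" by blast
    have "geom_series i j (\<lambda>l. int (m (i, j)) * root_vec i j l) \<noteq> 0" if "(i, j) \<in> R" for i j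
      using irrefl[OF that] by (simp add: geom_series_multiple)
    then have "\<alpha> \<in> (\<Pi>\<^sub>E r\<in>R. {a. (\<lambda>(i, j). geom_series i j) r a \<noteq> 0})"
      unfolding \<alpha> by (auto simp: case_prod_unfold)
    moreover have "(\<lambda>l. \<Sum>r\<in>R. \<alpha> r l) = \<gamma>"
      using m by (auto simp: \<alpha> root_decomps_def)
    ultimately show "\<alpha> \<in> ?D" by (simp add: decomps_def)
  next
    fix \<alpha> assume \<alpha>: "\<alpha> \<in> ?D"
    have "\<exists>m. \<alpha> r = (\<lambda>l. int m * root_vec (fst r) (snd r) l)" if "r \<in> R" for r
    proof -
      have "geom_series (fst r) (snd r) (\<alpha> r) \<noteq> 0"
        using \<alpha> that by (cases r) (fastforce simp: decomps_def PiE_def Pi_def)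
      then show ?thesis by (rule geom_series_nonzeroE) blast
    qed
    then obtain m where m: "\<And>r. r \<in> R \<Longrightarrow> \<alpha> r = (\<lambda>l. int (m r) * root_vec (fst r) (snd r) l)"
      by metis
    have "\<alpha> = ?f (restrict m R)"
      using \<alpha> m by (auto simp: decomps_def PiE_def extensional_def fun_eq_iff)
    moreover have "restrict m R \<in> root_decomps R \<gamma>"
      using \<alpha> m by (auto simp: root_decomps_def decomps_def)
    ultimately show "\<alpha> \<in> ?f ` root_decomps R \<gamma>" by blast
  qed
qed

text \<open>Every summand is a power of \<open>q\<close> with coefficient 1, so nothing cancels:
  nonvanishing and degree can be read off from the decompositions.\<close>

lemma K_poly_eq_sum_root_decomps:
  assumes irrefl: "\<And>i j. (i, j) \<in> R \<Longrightarrow> i \<noteq> j"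
  shows "K_poly R \<gamma> = (\<Sum>m\<in>root_decomps R \<gamma>. monom 1 (\<Sum>r\<in>R. m r))"
proof -
  let ?F = "\<lambda>(i, j). geom_series i j"
  have prod_monom: "(\<Prod>r\<in>A. monom (1 :: int) (m r)) = monom 1 (\<Sum>r\<in>A. m r)"
    for A and m :: "nat \<times> nat \<Rightarrow> nat"
    by (induction A rule: infinite_finite_induct) (auto simp: mult_monom)
  have "K_poly R \<gamma> = (\<Sum>m\<in>root_decomps R \<gamma>.
      \<Prod>r\<in>R. ?F r ((\<lambda>r\<in>R. \<lambda>l. int (m r) * root_vec (fst r) (snd r) l) r))"
    unfolding K_poly_def series_prod_def
    by (rule sum.reindex_bij_betw[OF bij_betw_root_decomps[OF irrefl], symmetric])
  also have "\<dots> = (\<Sum>m\<in>root_decomps R \<gamma>. \<Prod>r\<in>R. monom 1 (m r))"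
    by (intro sum.cong prod.cong) (auto simp: geom_series_multiple irrefl)
  finally show ?thesis by (simp add: prod_monom)
qed

text \<open>After exchanging the sums, a root counts 1 if it leads out of \<open>S\<close>, -1 if it
  leads into \<open>S\<close>, and 0 otherwise.\<close>

lemma sum_root_decomp:
  assumes "m \<in> root_decomps R \<gamma>" "finite S"
  shows "sum \<gamma> S = (\<Sum>r\<in>R. int (m r) * (of_bool (fst r \<in> S) - of_bool (snd r \<in> S)))"
proof -
  have \<gamma>: "\<gamma> = (\<lambda>l. \<Sum>r\<in>R. int (m r) * root_vec (fst r) (snd r) l)"
    using assms(1) by (simp add: root_decomps_def)
  have "sum \<gamma> S = (\<Sum>r\<in>R. \<Sum>l\<in>S. int (m r) * root_vec (fst r) (snd r) l)"
    by (subst \<gamma>) (rule sum.swap)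
  then show ?thesis by (simp add: sum_distrib_left[symmetric] sum_root_vec assms(2))
qed

section \<open>Partial sums of a composition\<close>

lemma psum_0 [simp]: "psum \<eta> 0 = 0"
  by (simp add: psum_def)

lemma psum_length [simp]: "psum \<eta> (length \<eta>) = sum_list \<eta>"
  by (simp add: psum_def)

lemma psum_Suc: "k < length \<eta> \<Longrightarrow> psum \<eta> (Suc k) = psum \<eta> k + \<eta> ! k"
  by (simp add: psum_def take_Suc_conv_app_nth)

lemma psum_mono: "k \<le> l \<Longrightarrow> psum \<eta> k \<le> psum \<eta> l"
proof (induction rule: dec_induct)
  case (step l)
  then show ?case by (cases "l < length \<eta>") (auto simp: psum_Suc, simp add: psum_def)
qed simp

lemma psum_less_Suc:
  assumes "is_composition n \<eta>" "k < length \<eta>"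
  shows "psum \<eta> k < psum \<eta> (Suc k)"
  using assms by (simp add: psum_Suc is_composition_def)

lemma less_if_psum_less: "psum \<eta> k < psum \<eta> l \<Longrightarrow> k < l"
  using psum_mono[of l k \<eta>] by (meson not_le)

text \<open>Since \<open>\<Omega>\<close> is disjoint from the initial segment, each condition
  concerns the sum over a single set, the form that root decompositions control.\<close>

lemma Y_set_iff:
  "\<gamma> \<in> Y_set \<eta> \<longleftrightarrow> \<gamma> \<in> int_vecs (sum_list \<eta>) \<and> (\<Sum>i = 1..sum_list \<eta>. \<gamma> i) = 0 \<and>
     (\<forall>k < length \<eta>. \<forall>\<Omega> \<subseteq> {psum \<eta> k + 1..psum \<eta> (k + 1)}. 0 \<le> sum \<gamma> ({1..psum \<eta> k} \<union> \<Omega>))"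
proof -
  have "sum \<gamma> ({1..psum \<eta> k} \<union> \<Omega>) = (\<Sum>j = 1..psum \<eta> k. \<gamma> j) + (\<Sum>a\<in>\<Omega>. \<gamma> a)"
    if "\<Omega> \<subseteq> {psum \<eta> k + 1..psum \<eta> (k + 1)}" for k \<Omega>
    by (rule sum.union_disjoint) (use that in \<open>auto intro: finite_subset\<close>)
  then show ?thesis by (auto simp: Y_set_def)
qed

section \<open>Necessity of the inequalities and the degree bound\<close>

lemma Y_set_if_root_decomp:
  assumes m: "m \<in> root_decomps (roots \<eta>) \<gamma>"
    and "\<gamma> \<in> int_vecs (sum_list \<eta>)" "(\<Sum>i = 1..sum_list \<eta>. \<gamma> i) = 0"
  shows "\<gamma> \<in> Y_set \<eta>"
  unfolding Y_set_iff
proof (intro conjI allI impI)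
  fix k \<Omega> assume k: "k < length \<eta>" and \<Omega>: "\<Omega> \<subseteq> {psum \<eta> k + 1..psum \<eta> (k + 1)}"
  let ?S = "{1..psum \<eta> k} \<union> \<Omega>"
  have down: "i \<in> ?S" if ij: "(i, j) \<in> roots \<eta>" and j: "j \<in> ?S" for i j
  proof -
    obtain k' where k': "1 \<le> i" "i \<le> psum \<eta> k'" "psum \<eta> k' < j"
      using ij by (auto simp: roots_def)
    have "j \<le> psum \<eta> (Suc k)" using j \<Omega> psum_mono[of k "Suc k" \<eta>] by auto
    \<comment> \<open>The boundary \<open>psum \<eta> k'\<close> crossed by the root lies before
      \<open>j\<close>, hence before the end of the block containing \<open>\<Omega>\<close>; so
      \<open>i\<close> is already in the initial segment.\<close>
    then have "k' \<le> k" using k' less_if_psum_less[of \<eta> k' "Suc k"] by simp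
    then show ?thesis using k' psum_mono[of k' k \<eta>] by auto
  qed
  have "finite ?S" using \<Omega> by (auto intro: finite_subset)
  then have "sum \<gamma> ?S = (\<Sum>r\<in>roots \<eta>. int (m r) * (of_bool (fst r \<in> ?S) - of_bool (snd r \<in> ?S)))"
    by (rule sum_root_decomp[OF m])
  also have "\<dots> \<ge> 0"
  proof (intro sum_nonneg mult_nonneg_nonneg)
    fix r assume "r \<in> roots \<eta>"
    then have "snd r \<in> ?S \<Longrightarrow> fst r \<in> ?S" using down[of "fst r" "snd r"] by simp
    then show "0 \<le> of_bool (fst r \<in> ?S) - (of_bool (snd r \<in> ?S) :: int)"
      by (auto simp: of_bool_def)
  qed simp
  finally show "0 \<le> sum \<gamma> ?S" .
qed (use assms in auto)

lemma num_roots_le_block_height: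
  assumes m: "m \<in> root_decomps (roots \<eta>) \<gamma>"
  shows "int (\<Sum>r\<in>roots \<eta>. m r) \<le> block_height \<eta> \<gamma>"
proof -
  let ?c = "\<lambda>r k. of_bool (fst r \<in> {1..psum \<eta> k}) - of_bool (snd r \<in> {1..psum \<eta> k}) :: int"
  have crossed: "1 \<le> (\<Sum>k = 1..length \<eta> - 1. ?c r k)" if root: "r \<in> roots \<eta>" for r
  proof -
    obtain i j where r: "r = (i, j)" by (cases r)
    obtain k where k: "k \<in> {1..length \<eta>}" "1 \<le> i" "i \<le> psum \<eta> k" "psum \<eta> k < j" "j \<le> sum_list \<eta>"
      using root r unfolding roots_def by blast
    \<comment> \<open>The last boundary is \<open>n\<close> itself, and no root crosses it; thus
      every root crosses one of the boundaries counted by \<open>block_height\<close>.\<close>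
    have "k \<noteq> length \<eta>" using k by auto
    then have "k \<in> {1..length \<eta> - 1}" using k by auto
    then have "?c r k \<le> (\<Sum>k = 1..length \<eta> - 1. ?c r k)"
      using k by (intro member_le_sum) (auto simp: r of_bool_def)
    then show ?thesis using k r by simp
  qed
  have "int (\<Sum>r\<in>roots \<eta>. m r) = (\<Sum>r\<in>roots \<eta>. int (m r) * 1)" by simp
  also have "\<dots> \<le> (\<Sum>r\<in>roots \<eta>. int (m r) * (\<Sum>k = 1..length \<eta> - 1. ?c r k))"
    using crossed by (intro sum_mono mult_left_mono) auto
  also have "\<dots> = (\<Sum>k = 1..length \<eta> - 1. \<Sum>r\<in>roots \<eta>. int (m r) * ?c r k)"
    unfolding sum_distrib_left by (rule sum.swap)
  also have "\<dots> = block_height \<eta> \<gamma>"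
    by (simp add: block_height_def sum_root_decomp[OF m])
  finally show ?thesis .
qed

section \<open>Sufficiency by removing one root at a time\<close>

lemma block_height_nonneg:
  assumes "\<gamma> \<in> Y_set \<eta>"
  shows "0 \<le> block_height \<eta> \<gamma>"
  unfolding block_height_def
proof (rule sum_nonneg)
  fix k assume "k \<in> {1..length \<eta> - 1}"
  then have "k < length \<eta>" by auto
  then have "0 \<le> sum \<gamma> ({1..psum \<eta> k} \<union> {})" using assms unfolding Y_set_iff by blast
  then show "0 \<le> (\<Sum>j = 1..psum \<eta> k. \<gamma> j)" by simp
qed

text \<open>A root between adjacent blocks crosses one boundary, so the height drops by exactly 1.
  Only sets containing \<open>i\<close> but not \<open>j\<close> lose 1 from their sum, so the point
  is that these sums are positive.\<close>

lemma exists_root_diff_in_Y_set: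
  assumes comp: "is_composition n \<eta>" and Y: "\<gamma> \<in> Y_set \<eta>" and nz: "\<gamma> \<noteq> (\<lambda>_. 0)"
  obtains i j where "(i, j) \<in> roots \<eta>" "\<gamma> - root_vec i j \<in> Y_set \<eta>"
    "block_height \<eta> (\<gamma> - root_vec i j) = block_height \<eta> \<gamma> - 1"
proof -
  let ?p = "length \<eta>"
  have Y_sum: "0 \<le> sum \<gamma> ({1..psum \<eta> k} \<union> \<Omega>)"
    if "k < ?p" "\<Omega> \<subseteq> {psum \<eta> k + 1..psum \<eta> (k + 1)}" for k \<Omega>
    using Y that unfolding Y_set_iff by blast
  have vec: "\<gamma> \<in> int_vecs (sum_list \<eta>)" and sum0: "(\<Sum>i = 1..sum_list \<eta>. \<gamma> i) = 0"
    using Y unfolding Y_set_iff by auto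
  \<comment> \<open>\<open>P\<close> locates the first nonzero block: the least index produced below
    is \<open>Suc k\<close>, so that block is
    \<open>{psum \<eta> k + 1..psum \<eta> (Suc k)}\<close>.\<close>
  define P where "P = (\<lambda>k. \<exists>l \<in> {1..psum \<eta> k}. \<gamma> l \<noteq> 0)"
  have "P ?p" using nz vec by (fastforce simp: P_def int_vecs_def)
  moreover have "\<not> P 0" by (simp add: P_def)
  ultimately obtain k where k: "k < ?p" "\<And>l. l \<le> k \<Longrightarrow> \<not> P l" "P (Suc k)"
    using ex_least_nat_less[of P ?p] by blast
  have zero: "\<gamma> l = 0" if "l \<in> {1..psum \<eta> k}" for l
    using k(2)[of k] that by (auto simp: P_def)
  have nonneg: "0 \<le> \<gamma> l" if "l \<in> {1..psum \<eta> (Suc k)}" for l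
  proof (cases "l \<in> {1..psum \<eta> k}")
    case False
    \<comment> \<open>All entries before this block vanish, so the singleton \<open>{l}\<close> as
      \<open>\<Omega>\<close> isolates \<open>\<gamma> l\<close>.\<close>
    then have "0 \<le> sum \<gamma> ({1..psum \<eta> k} \<union> {l})" using that k(1) by (intro Y_sum) auto
    then show ?thesis using False zero by simp
  qed (simp add: zero)
  obtain i where i: "i \<in> {1..psum \<eta> (Suc k)}" "\<gamma> i \<noteq> 0" using k(3) by (auto simp: P_def)
  have i_pos: "1 \<le> \<gamma> i" using nonneg[OF i(1)] i(2) by simp
  have i_gt: "psum \<eta> k < i" using zero i by (meson atLeastAtMost_iff not_le)
  have pos_sum: "1 \<le> sum \<gamma> S" if "finite S" "i \<in> S" "\<And>l. l \<in> S \<Longrightarrow> 0 \<le> \<gamma> l" for S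
    using member_le_sum[of i S \<gamma>] i_pos that by auto
  \<comment> \<open>If the first nonzero block were the last, the total would be positive; hence
    there is a next block.\<close>
  have k1: "Suc k < ?p"
  proof (rule ccontr)
    assume "\<not> ?thesis"
    then have "Suc k = ?p" using k(1) by simp
    then have "1 \<le> (\<Sum>i = 1..sum_list \<eta>. \<gamma> i)"
      using i nonneg by (intro pos_sum) (auto simp flip: psum_length)
    then show False using sum0 by simp
  qed
  let ?B = "{psum \<eta> (Suc k) + 1..psum \<eta> (Suc (Suc k))}"
  obtain j where j: "j \<in> ?B" "\<gamma> j < 0 \<or> (\<forall>l \<in> ?B. 0 \<le> \<gamma> l)"
  proof (cases "\<exists>l \<in> ?B. \<gamma> l < 0")
    case True
    then show ?thesis using that by blast
  next
    case False
    \<comment> \<open>Without a negative entry any position in the block would do; the last one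
      exists because parts are positive.\<close>
    moreover have "psum \<eta> (Suc (Suc k)) \<in> ?B" using psum_less_Suc[OF comp k1] by simp
    ultimately show ?thesis using that by fastforce
  qed
  have j_le: "j \<le> sum_list \<eta>"
    using j psum_mono[of "Suc (Suc k)" ?p \<eta>] k1 by auto
  have root: "(i, j) \<in> roots \<eta>"
    using i j j_le k1 by (auto simp: roots_def intro!: bexI[of _ "Suc k"])
  have sum_diff: "sum (\<gamma> - root_vec i j) S = sum \<gamma> S - (of_bool (i \<in> S) - of_bool (j \<in> S))"
    if "finite S" for S
    using that by (simp add: sum_subtractf sum_root_vec)
  have "\<gamma> - root_vec i j \<in> Y_set \<eta>"
    unfolding Y_set_iff
  proof (intro conjI allI impI)
    show "\<gamma> - root_vec i j \<in> int_vecs (sum_list \<eta>)"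
      using vec i j j_le by (auto simp: int_vecs_def root_vec_def)
    show "(\<Sum>l = 1..sum_list \<eta>. (\<gamma> - root_vec i j) l) = 0"
      using sum0 i j j_le by (subst sum_diff) auto
  next
    fix l \<Omega> assume l: "l < ?p" and \<Omega>: "\<Omega> \<subseteq> {psum \<eta> l + 1..psum \<eta> (l + 1)}"
    let ?S = "{1..psum \<eta> l} \<union> \<Omega>"
    have fin: "finite ?S" using \<Omega> by (auto intro: finite_subset)
    have "1 \<le> sum \<gamma> ?S" if iS: "i \<in> ?S" and jS: "j \<notin> ?S"
    proof (cases "\<forall>a \<in> ?S. 0 \<le> \<gamma> a")
      case True
      then show ?thesis using pos_sum[OF fin iS] by blast
    next
      case False
      then obtain a where a: "a \<in> ?S" "\<gamma> a < 0" by (meson not_le)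
      have S_le: "b \<le> psum \<eta> (Suc l)" "1 \<le> b" if "b \<in> ?S" for b
        using that \<Omega> psum_mono[of l "Suc l" \<eta>] by auto
      \<comment> \<open>A negative entry lies beyond the first nonzero block, while
        \<open>j \<notin> ?S\<close> keeps the initial segment from containing the next one. This
        forces \<open>l = Suc k\<close>.\<close>
      have a_gt: "psum \<eta> (Suc k) < a"
        using nonneg[of a] a S_le(2)[of a] by (meson atLeastAtMost_iff not_le)
      have "Suc k < Suc l"
        by (rule less_if_psum_less[of \<eta>]) (use a_gt S_le(1)[of a] a(1) in linarith)
      moreover have "l < Suc (Suc k)"
        by (rule less_if_psum_less[of \<eta>]) (use jS j in \<open>auto simp: not_le\<close>)
      ultimately have lk: "l = Suc k" by simp
      then have "a \<in> ?B" using a_gt a S_le by auto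
      then have j_neg: "\<gamma> j < 0" using j(2) a(2) by force
      \<comment> \<open>Adding \<open>j\<close> gives another admissible set; its sum is nonnegative
        and \<open>\<gamma> j < 0\<close>, so the sum without \<open>j\<close> is at least
        1.\<close>
      have "0 \<le> sum \<gamma> ({1..psum \<eta> l} \<union> insert j \<Omega>)"
        using j \<Omega> lk l by (intro Y_sum) auto
      also have "\<dots> = \<gamma> j + sum \<gamma> ?S"
        using jS fin by simp
      finally show ?thesis using j_neg by simp
    qed
    moreover have "0 \<le> sum \<gamma> ?S" using Y_sum l \<Omega> by blast
    ultimately show "0 \<le> sum (\<gamma> - root_vec i j) ?S"
      unfolding sum_diff[OF fin] by (auto simp: of_bool_def)
  qed
  moreover have "block_height \<eta> (\<gamma> - root_vec i j) = block_height \<eta> \<gamma> - 1"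
  proof -
    have crossed: "i \<in> {1..psum \<eta> l} \<and> j \<notin> {1..psum \<eta> l} \<longleftrightarrow> l = Suc k" for l
    proof
      assume a: "i \<in> {1..psum \<eta> l} \<and> j \<notin> {1..psum \<eta> l}"
      have "k < l"
        by (rule less_if_psum_less[of \<eta>]) (use a i_gt in auto)
      moreover have "l < Suc (Suc k)"
        by (rule less_if_psum_less[of \<eta>]) (use a j in auto)
      ultimately show "l = Suc k" by simp
    qed (use i j in auto)
    have "j \<in> {1..psum \<eta> l} \<Longrightarrow> i \<in> {1..psum \<eta> l}" for l
      using i j by auto
    then have "of_bool (i \<in> {1..psum \<eta> l}) - of_bool (j \<in> {1..psum \<eta> l})
        = (if l = Suc k then 1 else 0 :: int)" for l
      using crossed[of l] by (auto simp: of_bool_def)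
    then have "block_height \<eta> (\<gamma> - root_vec i j)
        = block_height \<eta> \<gamma> - (\<Sum>l = 1..?p - 1. if l = Suc k then 1 else 0)"
      unfolding block_height_def by (simp only: sum_diff finite_atLeastAtMost sum_subtractf)
    also have "\<dots> = block_height \<eta> \<gamma> - 1" using k1 by simp
    finally show ?thesis .
  qed
  ultimately show thesis using that root by blast
qed

lemma root_decomps_add_root:
  assumes "finite R" "(i, j) \<in> R" "m \<in> root_decomps R (\<gamma> - root_vec i j)"
  shows "m((i, j) := Suc (m (i, j))) \<in> root_decomps R \<gamma>"
    and "(\<Sum>r\<in>R. (m((i, j) := Suc (m (i, j)))) r) = Suc (\<Sum>r\<in>R. m r)"
proof -
  let ?m = "m((i, j) := Suc (m (i, j)))"
  have upd: "?m r = m r + (if r = (i, j) then 1 else 0)" for r by simp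
  have decomp: "(\<lambda>l. \<Sum>r\<in>R. int (m r) * root_vec (fst r) (snd r) l) = \<gamma> - root_vec i j"
    using assms(3) by (simp add: root_decomps_def)
  have "(\<Sum>r\<in>R. int (?m r) * root_vec (fst r) (snd r) l) = \<gamma> l" for l
  proof -
    have "(\<Sum>r\<in>R. int (?m r) * root_vec (fst r) (snd r) l)
        = (\<Sum>r\<in>R. int (m r) * root_vec (fst r) (snd r) l
            + (if r = (i, j) then root_vec i j l else 0))"
      by (intro sum.cong) (auto simp: algebra_simps)
    also have "\<dots> = (\<gamma> - root_vec i j) l + root_vec i j l"
      using assms fun_cong[OF decomp, of l] by (simp add: sum.distrib)
    finally show ?thesis by simp
  qed
  then show "?m \<in> root_decomps R \<gamma>"
    using assms by (auto simp: root_decomps_def PiE_def extensional_def fun_eq_iff)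
  show "(\<Sum>r\<in>R. ?m r) = Suc (\<Sum>r\<in>R. m r)"
    using assms unfolding upd by (simp add: sum.distrib)
qed

text \<open>Each removed root lowers the height by 1 and accounts for one root of the decomposition,
  so the count equals the height once zero is reached.\<close>

lemma exists_root_decomp_block_height:
  assumes comp: "is_composition n \<eta>" and "\<gamma> \<in> Y_set \<eta>"
  shows "\<exists>m \<in> root_decomps (roots \<eta>) \<gamma>. int (\<Sum>r\<in>roots \<eta>. m r) = block_height \<eta> \<gamma>"
  using assms(2)
proof (induction "nat (block_height \<eta> \<gamma>)" arbitrary: \<gamma> rule: less_induct)
  case less
  show ?case
  proof (cases "\<gamma> = (\<lambda>_. 0)")
    case True
    then have "(\<lambda>r\<in>roots \<eta>. 0) \<in> root_decomps (roots \<eta>) \<gamma>"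
      by (simp add: root_decomps_def)
    moreover have "block_height \<eta> \<gamma> = 0" using True by (simp add: block_height_def)
    ultimately show ?thesis by (intro bexI[of _ "\<lambda>r\<in>roots \<eta>. 0"]) auto
  next
    case False
    obtain i j where ij: "(i, j) \<in> roots \<eta>" "\<gamma> - root_vec i j \<in> Y_set \<eta>"
      "block_height \<eta> (\<gamma> - root_vec i j) = block_height \<eta> \<gamma> - 1"
      using exists_root_diff_in_Y_set[OF comp less.prems False] .
    \<comment> \<open>Nonnegativity after the removal makes the height before it at least 1, so
      truncation by \<open>nat\<close> does no harm.\<close>
    have "nat (block_height \<eta> (\<gamma> - root_vec i j)) < nat (block_height \<eta> \<gamma>)"
      using ij(3) block_height_nonneg[OF ij(2)] by simp
    then obtain m where m: "m \<in> root_decomps (roots \<eta>) (\<gamma> - root_vec i j)"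
      "int (\<Sum>r\<in>roots \<eta>. m r) = block_height \<eta> (\<gamma> - root_vec i j)"
      using less.hyps[OF _ ij(2)] by blast
    show ?thesis
      using root_decomps_add_root[OF finite_roots ij(1) m(1)] m(2) ij(3)
      by (intro bexI[of _ "m((i, j) := Suc (m (i, j)))"]) auto
  qed
qed

text \<open>Abel summation: block \<open>k\<close> occurs in the partial sums up to
  \<open>k\<close>, \<open>k + 1\<close>, and so on to \<open>p - 1\<close>, that is,
  \<open>p - k\<close> times for \<open>p = length \<eta>\<close>.\<close>

lemma block_height_by_parts:
  "block_height \<eta> \<gamma> = (\<Sum>k = 1..length \<eta> - 1. (int (length \<eta>) - int k) *
     (\<Sum>j = psum \<eta> (k - 1) + 1..psum \<eta> k. \<gamma> j))"
proof -
  define S where "S = (\<lambda>k. \<Sum>j = 1..psum \<eta> k. \<gamma> j)"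
  define B where "B = (\<lambda>k. \<Sum>j = psum \<eta> (k - 1) + 1..psum \<eta> k. \<gamma> j)"
  have S_step: "S (Suc k) = S k + B (Suc k)" for k
    using psum_mono[of k "Suc k" \<eta>]
      sum.ub_add_nat[of 1 "psum \<eta> k" \<gamma> "psum \<eta> (Suc k) - psum \<eta> k"]
    by (simp add: S_def B_def)
  have S_sum: "S N = (\<Sum>k = 1..N. B k)" for N
    by (induction N) (auto simp: S_step, simp add: S_def)
  \<comment> \<open>Stated for all \<open>N\<close> to allow induction; \<open>N + 1\<close> becomes
    \<open>length \<eta>\<close> in the application.\<close>
  have parts: "(\<Sum>k = 1..N. S k) = (\<Sum>k = 1..N. (int N + 1 - int k) * B k)" for N
  proof (induction N)
    case (Suc N)
    have "(\<Sum>k = 1..Suc N. (int (Suc N) + 1 - int k) * B k)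
        = (\<Sum>k = 1..N. (int N + 1 - int k) * B k + B k) + B (Suc N)"
      by (simp add: algebra_simps)
    also have "\<dots> = (\<Sum>k = 1..N. S k) + S N + B (Suc N)"
      by (simp only: Suc.IH sum.distrib S_sum[symmetric])
    finally show ?case by (simp add: S_step)
  qed simp
  show ?thesis
  proof (cases "length \<eta>")
    case (Suc N)
    then show ?thesis using parts[of N] by (simp add: block_height_def S_def B_def add.commute)
  qed (simp add: block_height_def)
qed

theorem theorem3p15:
  fixes \<eta> :: "nat list" and n p :: nat and \<gamma> :: "nat \<Rightarrow> int"
  assumes "is_composition n \<eta>" and "p = length \<eta>"
    and "\<gamma> \<in> int_vecs n" and "(\<Sum>i = 1..n. \<gamma> i) = 0"
  shows "(K_poly (roots \<eta>) \<gamma> \<noteq> 0 \<longleftrightarrow> \<gamma> \<in> Y_set \<eta>) \<and>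
    (\<gamma> \<in> Y_set \<eta> \<longrightarrow>
      int (degree (K_poly (roots \<eta>) \<gamma>)) =
        (\<Sum>k = 1..p - 1. (int p - int k) * (\<Sum>j = psum \<eta> (k - 1) + 1..psum \<eta> k. \<gamma> j)))"
proof -
  let ?R = "roots \<eta>" and ?K = "K_poly (roots \<eta>) \<gamma>"
  have irrefl: "i \<noteq> j" if "(i, j) \<in> ?R" for i j using that roots_subset[of \<eta>] by auto
  have K: "?K = (\<Sum>m\<in>root_decomps ?R \<gamma>. monom 1 (\<Sum>r\<in>?R. m r))"
    by (rule K_poly_eq_sum_root_decomps[OF irrefl])
  \<comment> \<open>Finiteness ensures that the sum in \<open>K\<close> is a genuine one and not the
    default 0.\<close>
  have fin: "finite (root_decomps ?R \<gamma>)"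
    using bij_betw_finite[OF bij_betw_root_decomps[OF irrefl]] finite_decomps_roots by blast
  have n: "n = sum_list \<eta>" using assms(1) by (simp add: is_composition_def)
  have to_Y: "\<gamma> \<in> Y_set \<eta>" if "?K \<noteq> 0"
  proof -
    have "root_decomps ?R \<gamma> \<noteq> {}" using that K by (metis sum.empty)
    then show ?thesis using Y_set_if_root_decomp assms n by blast
  qed
  have from_Y: "?K \<noteq> 0 \<and> int (degree ?K) = block_height \<eta> \<gamma>" if Y: "\<gamma> \<in> Y_set \<eta>"
  proof -
    obtain m where m: "m \<in> root_decomps ?R \<gamma>" "int (\<Sum>r\<in>?R. m r) = block_height \<eta> \<gamma>"
      using exists_root_decomp_block_height[OF assms(1) Y] by blast
    let ?d = "\<Sum>r\<in>?R. m r"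
    \<comment> \<open>All contributions to the coefficient of \<open>q\<close> to the power
      \<open>?d\<close> are nonnegative, and \<open>m\<close> alone contributes 1.\<close>
    have "0 < (1 :: int)" by simp
    also have "\<dots> = coeff (monom 1 ?d) ?d" by simp
    also have "\<dots> \<le> (\<Sum>m\<in>root_decomps ?R \<gamma>. coeff (monom 1 (\<Sum>r\<in>?R. m r)) ?d)"
      using fin m(1) by (intro member_le_sum[where f = "\<lambda>m. coeff (monom 1 (\<Sum>r\<in>?R. m r)) ?d"]) auto
    finally have "coeff ?K ?d \<noteq> 0" by (simp add: K coeff_sum)
    then have "?K \<noteq> 0" "?d \<le> degree ?K" by (auto intro: le_degree)
    moreover have "degree ?K \<le> ?d"
      unfolding K
    proof (rule degree_sum_le[OF fin])
      fix m' assume "m' \<in> root_decomps ?R \<gamma>"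
      \<comment> \<open>The height bounds the number of roots in every decomposition, and
        \<open>m\<close> attains it.\<close>
      then have "(\<Sum>r\<in>?R. m' r) \<le> ?d" using num_roots_le_block_height m(2) by (metis of_nat_le_iff)
      then show "degree (monom (1 :: int) (\<Sum>r\<in>?R. m' r)) \<le> ?d"
        using degree_monom_le order_trans by blast
    qed
    ultimately show ?thesis using m(2) by (metis order_antisym)
  qed
  show ?thesis
    using to_Y from_Y by (auto simp: assms(2) block_height_by_parts)
qed

end
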